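(* Let $p,q\in[0,1]$ and let $(G_t)_{t\ge 0}$ be the growing directed graph generated by the basic forest fire model with parameters $p,q$ (defined in the context), started from an arbitrary weakly connected directed graph $G_0$. Then there is a constant $C$, not depending on $n$, such that asymptotically almost surely (as $n\to\infty$) for every vertex $v$ of $G_n$ there exists a directed path of length at most $e\log n + C$ connecting $v$ to some vertex of $G_0$. In particular, there is a constant $C'$, not depending on $n$, such that asymptotically almost surely the diameter of $G_n$ is at most $2e\log n + C'$.
   Context: Conventions: $\mathbb N=\{1,2,\dots\}$, $\mathbb N_0=\{0,1,2,\dots\}$; $\log$ is the natural logarithm and $e$ its base. Graphs are finite and may have loops and parallel edges. Distance between two vertices of a directed graph is the number of edges in a shortest path ignoring edge directions; the diameter is the maximum distance between two vertices. The initial graph $G_0$ is finite of size $O(1)$ (bounded independently of $n$). "Asymptotically almost surely" means with probability tending to $1$ as $n\to\infty$. All random choices at time $t$ have the stated distributions conditionally on the history of the process up to time $t-1$. $\operatorname{Geo}(p)$ denotes a random variable with $\mathbb P[\operatorname{Geo}(p)=k]=(1-p)^kp$ for $k\in\mathbb N_0$ (for $p=0$ use the convention $\operatorname{Geo}(0)=\infty$). Basic forest fire model: $G_0$ is an arbitrary weakly connected directed graph. At each time-step $t\in\mathbb N$, $G_t$ is obtained from $G_{t-1}$ by adding a new vertex $v$ and edges from $v$ to vertices of $G_{t-1}$ by the following process. 1. All vertices are marked "unvisited". An ambassador vertex $W$ is sampled uniformly from the vertices of $G_{t-1}$. 2. Vertex $v$ is joined to $W$ (by an edge directed from $v$ to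 $W$) and $W$ is marked "visited". 3. Independently generate $X=\operatorname{Geo}(p)$ and $Y=\operatorname{Geo}(q)$. Randomly select $X$ unvisited out-neighbours and $Y$ unvisited in-neighbours of $W$; if not enough unvisited in-neighbours or out-neighbours are available, select as many as possible. Let $W_1,\dots,W_Z$ be the selected vertices. 4. Vertex $v$ is joined (by edges directed from $v$) to $W_1,\dots,W_Z$, and then steps 2--4 are applied recursively to each of $W_1,\dots,W_Z$. *)

theory Defs
  imports
    "HOL-Probability.Probability"
    "HOL-Combinatorics.Multiset_Permutations"
    "Graph_Theory.Graph_Theory"
begin

text \<open>
  \<^term>\<open>geometric_pmf p\<close> is a genuine geometric distribution only for \<open>0 < p \<le> 1\<close>, hence the
  separate case for the convention \<open>Geo(0) = \<infinity>\<close>.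
\<close>

definition Geo :: "real \<Rightarrow> enat pmf" where
  "Geo p = (if p = 0 then return_pmf \<infinity> else map_pmf enat (geometric_pmf p))"

text \<open>A uniformly random \<open>k\<close>-element subset of \<open>U\<close>, or all of \<open>U\<close> if it has fewer than \<open>k\<close> elements.\<close>

definition random_subset :: "enat \<Rightarrow> 'v set \<Rightarrow> 'v set pmf" where
  "random_subset k U = pmf_of_set {A. A \<subseteq> U \<and> enat (card A) = min k (enat (card U))}"

text \<open>
  A neighbour selected both as an out- and as an in-neighbour is listed once; the selected
  vertices \<open>W\<^sub>1, \<dots>, W\<^sub>Z\<close> are listed in uniformly random order.
\<close>

definition select_neighbours ::
    "real \<Rightarrow> real \<Rightarrow> ('v, 'e) pre_digraph \<Rightarrow> 'v set \<Rightarrow> 'v \<Rightarrow> 'v list pmf" where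
  "select_neighbours p q G visited w = do {
     x \<leftarrow> Geo p;
     y \<leftarrow> Geo q;
     A \<leftarrow> random_subset x {u \<in> verts G. w \<rightarrow>\<^bsub>G\<^esub> u \<and> u \<notin> visited};
     B \<leftarrow> random_subset y {u \<in> verts G. u \<rightarrow>\<^bsub>G\<^esub> w \<and> u \<notin> visited};
     pmf_of_set (permutations_of_set (A \<union> B))
   }"

lemma set_pmf_random_subset:
  assumes "finite U" "A \<in> set_pmf (random_subset k U)"
  shows "A \<subseteq> U"
proof -
  let ?F = "{A. A \<subseteq> U \<and> enat (card A) = min k (enat (card U))}"
  obtain m where m: "min k (enat (card U)) = enat m" "m \<le> card U"
  proof (cases "k \<le> enat (card U)")
    case True
    then obtain m where "k = enat m" by (cases k) auto
    with True show ?thesis by (intro that[of m]) auto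
  next
    case False
    then show ?thesis by (intro that[of "card U"]) (auto simp: min_def)
  qed
  obtain B where "B \<subseteq> U" "card B = m"
    using obtain_subset_with_card_n[OF m(2)] by blast
  then have "?F \<noteq> {}" using m by auto
  moreover have "finite ?F" using assms(1) by simp
  ultimately have "set_pmf (random_subset k U) = ?F"
    unfolding random_subset_def by (rule set_pmf_of_set)
  then show ?thesis using assms(2) by auto
qed

lemma set_pmf_select_neighbours:
  assumes "finite (verts G)" "xs \<in> set_pmf (select_neighbours p q G visited w)"
  shows "set xs \<subseteq> verts G - visited"
proof -
  let ?O = "{u \<in> verts G. w \<rightarrow>\<^bsub>G\<^esub> u \<and> u \<notin> visited}"
  let ?I = "{u \<in> verts G. u \<rightarrow>\<^bsub>G\<^esub> w \<and> u \<notin> visited}"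
  obtain x y A B where A: "A \<in> set_pmf (random_subset x ?O)"
    and B: "B \<in> set_pmf (random_subset y ?I)"
    and xs: "xs \<in> set_pmf (pmf_of_set (permutations_of_set (A \<union> B)))"
    using assms(2) unfolding select_neighbours_def by auto
  have AB: "A \<subseteq> ?O" "B \<subseteq> ?I"
    using set_pmf_random_subset[OF _ A] set_pmf_random_subset[OF _ B] assms(1) by auto
  then have "finite (A \<union> B)"
    using assms(1) by (auto intro: finite_subset)
  then have "xs \<in> permutations_of_set (A \<union> B)"
    using xs by (simp add: set_pmf_of_set)
  then show ?thesis
    using AB by (auto simp: permutations_of_set_def)
qed

text \<open>
  The recursion is run depth-first: the list holds the vertices to which the process still has to
  be applied. It is applied to every selected vertex, even if the vertex has been marked visited
  in the meantime. The result is the final set of visited vertices, which is exactly the set of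
  vertices that the new vertex is joined to. The finiteness test only serves totality.
\<close>

function burn ::
    "real \<Rightarrow> real \<Rightarrow> ('v, 'e) pre_digraph \<Rightarrow> 'v set \<Rightarrow> 'v list \<Rightarrow> 'v set pmf" where
  "burn p q G visited [] = return_pmf visited"
| "burn p q G visited (w # ws) =
    (if finite (verts G) then do {
       xs \<leftarrow> select_neighbours p q G (insert w visited) w;
       burn p q G (insert w visited) (xs @ ws)
     } else return_pmf visited)"
  by pat_completeness auto

termination
proof (relation "inv_image (less_than <*lex*> less_than <*lex*> less_than)
    (\<lambda>(p, q, G, visited, ws). (card (verts G - visited),
       if ws \<noteq> [] \<and> hd ws \<in> verts G - visited then 0 else 1 :: nat, length ws))", goal_cases)
  case 1
  show ?case by (intro wf_inv_image wf_lex_prod wf_less_than)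
next
  case (2 p q G visited w ws xs)
  have sub: "set xs \<subseteq> verts G - insert w visited"
    using set_pmf_select_neighbours 2 by metis
  show ?case
  proof (cases "w \<in> verts G - visited")
    case True
    then have "verts G - insert w visited \<subset> verts G - visited" by auto
    then have "card (verts G - insert w visited) < card (verts G - visited)"
      using 2 by (intro psubset_card_mono) auto
    then show ?thesis by simp
  next
    case False
    then have eq: "verts G - insert w visited = verts G - visited" by auto
    then have "card (verts G - insert w visited) = card (verts G - visited)" by simp
    then show ?thesis
      using False sub by (cases xs) auto
  qed
qed

text \<open>
  \<open>Init x\<close> and \<open>InitArc a\<close> are the vertices and arcs of the initial graph, \<open>New t\<close> is the vertex
  added at time \<open>t\<close>, and \<open>NewArc t w\<close> is the arc from \<open>New t\<close> to \<open>w\<close>.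
\<close>

datatype 'a vertex = Init 'a | New nat

datatype ('a, 'b) edge = InitArc 'b | NewArc nat "'a vertex"

fun arc_tail :: "('a, 'b) pre_digraph \<Rightarrow> ('a, 'b) edge \<Rightarrow> 'a vertex" where
  "arc_tail G0 (InitArc a) = Init (tail G0 a)"
| "arc_tail G0 (NewArc t w) = New t"

fun arc_head :: "('a, 'b) pre_digraph \<Rightarrow> ('a, 'b) edge \<Rightarrow> 'a vertex" where
  "arc_head G0 (InitArc a) = Init (head G0 a)"
| "arc_head G0 (NewArc t w) = w"

definition initial_graph ::
    "('a, 'b) pre_digraph \<Rightarrow> ('a vertex, ('a, 'b) edge) pre_digraph" where
  "initial_graph G0 =
     \<lparr>verts = Init ` verts G0, arcs = InitArc ` arcs G0, tail = arc_tail G0, head = arc_head G0\<rparr>"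

definition join_new_vertex ::
    "nat \<Rightarrow> 'a vertex set \<Rightarrow> ('a vertex, ('a, 'b) edge) pre_digraph
      \<Rightarrow> ('a vertex, ('a, 'b) edge) pre_digraph" where
  "join_new_vertex t S G =
     G\<lparr>verts := insert (New t) (verts G), arcs := arcs G \<union> NewArc t ` S\<rparr>"

text \<open>
  The law of \<open>G\<^sub>t\<close>. Given the history up to time \<open>t\<close>, the law of \<open>G\<^sub>t\<^sub>+\<^sub>1\<close> depends on \<open>G\<^sub>t\<close> only.
\<close>

primrec forest_fire ::
    "real \<Rightarrow> real \<Rightarrow> ('a, 'b) pre_digraph \<Rightarrow> nat \<Rightarrow> ('a vertex, ('a, 'b) edge) pre_digraph pmf" where
  "forest_fire p q G0 0 = return_pmf (initial_graph G0)"
| "forest_fire p q G0 (Suc t) = do {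
     G \<leftarrow> forest_fire p q G0 t;
     w \<leftarrow> pmf_of_set (verts G);
     S \<leftarrow> burn p q G {} [w];
     return_pmf (join_new_vertex (Suc t) S G)
   }"

definition undirected_dist :: "('v, 'e) pre_digraph \<Rightarrow> 'v \<Rightarrow> 'v \<Rightarrow> ereal" where
  "undirected_dist G u v = wf_digraph.\<mu> (with_proj (mk_symmetric G)) (\<lambda>_. 1) u v"

definition graph_diameter :: "('v, 'e) pre_digraph \<Rightarrow> ereal" where
  "graph_diameter G = (SUP u\<in>verts G. SUP v\<in>verts G. undirected_dist G u v)"

definition asymptotically_almost_surely :: "(nat \<Rightarrow> 'g pmf) \<Rightarrow> (nat \<Rightarrow> 'g \<Rightarrow> bool) \<Rightarrow> bool" where
  "asymptotically_almost_surely M P \<longleftrightarrow>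
     (\<lambda>n. measure_pmf.prob (M n) {g. P n g}) \<longlonglongrightarrow> 1"

end

theory Submission
  imports Defs "HOL-Real_Asymp.Real_Asymp"
begin

text \<open>
  Only the edge from a new vertex to its ambassador matters: it makes the directed distance to
  \<open>G\<^sub>0\<close> of the new vertex at most one more than that of a uniformly random old vertex, as in a
  random recursive tree. Let \<open>m\<close> be the number of vertices of \<open>G\<^sub>0\<close> and let \<open>a\<^sub>j(t)\<close> be the
  expected number of vertices of \<open>G\<^sub>t\<close> at distance at least \<open>j\<close>. Then
  \<open>a\<^sub>j(t + 1) \<le> a\<^sub>j(t) + a\<^sub>j\<^sub>-\<^sub>1(t) / (m + t)\<close>, so \<open>a\<^sub>j(t) \<le> m F\<^sub>j(L\<^sub>t)\<close> where
  \<open>L\<^sub>t = \<Sum>s<t. 1 / (m + s) \<le> 1 + ln t\<close> and \<open>F\<^sub>j(x) = \<Sum>i\<ge>j. x\<^sup>i / i!\<close> satisfies \<open>F\<^sub>j' = F\<^sub>j\<^sub>-\<^sub>1\<close>.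
  For \<open>k \<ge> e (1 + ln n)\<close> the first term dominates: \<open>F\<^sub>k(L\<^sub>n) \<le> 2 L\<^sub>n\<^sup>k / k! \<le> 2 (k / e)\<^sup>k / k!\<close>,
  which tends to 0. A plain exponential moment would only bound the probability by a constant;
  the decay comes from the factor \<open>1 / sqrt k\<close> in Stirling's formula, for which a weaker
  elementary bound suffices.
\<close>

section \<open>Tails of the exponential series\<close>

text \<open>The \<open>F\<^sub>k\<close> of the overview. As \<open>exp\<close> minus a finite sum
  it can be differentiated by induction on \<open>k\<close>; the series form in
  \<open>exp_tail_eq_suminf\<close> serves the sign and the upper bound.\<close>

definition exp_tail :: "nat \<Rightarrow> real \<Rightarrow> real" where
  "exp_tail k x = exp x - (\<Sum>i<k. x ^ i / fact i)"

lemma exp_tail_eq_suminf: "exp_tail k x = (\<Sum>i. x ^ (i + k) / fact (i + k))"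
  using exp_first_terms[of x k] by (simp add: exp_tail_def divide_inverse mult.commute)

lemma exp_tail_nonneg: "exp_tail k x \<ge> 0" if "x \<ge> 0"
proof -
  have "summable (\<lambda>i. x ^ (i + k) / fact (i + k))"
    using summable_ignore_initial_segment[OF summable_exp[of x], of k]
    by (simp add: divide_inverse mult.commute)
  then show ?thesis
    unfolding exp_tail_eq_suminf using that by (intro suminf_nonneg) auto
qed

text \<open>For \<open>k = 0\<close> the truncated difference \<open>k - 1 = 0\<close> is right, since \<^term>\<open>exp_tail 0\<close> is \<^term>\<open>exp\<close>.\<close>

lemma has_real_derivative_exp_tail:
  "(exp_tail k has_real_derivative exp_tail (k - 1) x) (at x)"
proof (induction k)
  case 0
  then show ?case
    unfolding exp_tail_def by (auto intro!: derivative_eq_intros)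
next
  case (Suc k)
  have eq: "exp_tail (Suc k) = (\<lambda>x. exp_tail k x - x ^ k / fact k)"
    by (auto simp: exp_tail_def fun_eq_iff)
  \<comment> \<open>The derivative of \<open>x ^ k / fact k\<close> is exactly the term by which
    \<open>exp_tail (k - 1)\<close> exceeds \<open>exp_tail k\<close>. For \<open>k = 0\<close> both
    tails are \<open>exp\<close> and the factor \<open>real k\<close> vanishes.\<close>
  have "exp_tail (Suc k - 1) x = exp_tail (k - 1) x - real k * x ^ (k - 1) / fact k"
  proof (cases k)
    case (Suc m)
    have "real (Suc m) * x ^ m / fact (Suc m) = x ^ m / fact m"
      by (simp del: of_nat_Suc)
    then show ?thesis
      by (simp add: Suc exp_tail_def del: fact_Suc of_nat_Suc)
  qed (simp add: exp_tail_def)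
  then show ?case
    unfolding eq by (auto intro!: derivative_eq_intros Suc.IH simp del: diff_Suc_1)
qed

lemma mono_exp_tail: "exp_tail k x \<le> exp_tail k y" if "0 \<le> x" "x \<le> y"
proof (rule DERIV_nonneg_imp_nondecreasing[OF that(2)])
  fix z assume "x \<le> z"
  with that have "0 \<le> exp_tail (k - 1) z" by (intro exp_tail_nonneg) simp
  then show "\<exists>d. (exp_tail k has_real_derivative d) (at z) \<and> 0 \<le> d"
    using has_real_derivative_exp_tail by blast
qed

text \<open>Convexity: the derivative \<open>exp_tail (k - 1)\<close> is itself nondecreasing on the
  nonnegative reals, so the mean value theorem bounds the increment below by the slope at the left
  end. With \<open>h = 1 / (m + t)\<close> this absorbs one time step of the recursion.\<close>

lemma exp_tail_add_ge:
  assumes "0 \<le> x" "0 \<le> h"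
  shows "exp_tail k x + h * exp_tail (k - 1) x \<le> exp_tail k (x + h)"
proof (cases "h = 0")
  case False
  with assms have "x < x + h" by simp
  then obtain z where z: "x < z" "z < x + h"
    "exp_tail k (x + h) - exp_tail k x = (x + h - x) * exp_tail (k - 1) z"
    using MVT2[of x "x + h" "exp_tail k" "exp_tail (k - 1)"] has_real_derivative_exp_tail by blast
  have "exp_tail (k - 1) x \<le> exp_tail (k - 1) z"
    using z assms by (intro mono_exp_tail) auto
  then have "h * exp_tail (k - 1) x \<le> h * exp_tail (k - 1) z"
    using assms by (intro mult_left_mono) auto
  moreover have "exp_tail k (x + h) - exp_tail k x = h * exp_tail (k - 1) z"
    using z by simp
  ultimately show ?thesis by linarith
qed simp

text \<open>Each of the \<open>i\<close> factors from \<open>k + 1\<close> to \<open>k + i\<close>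
  is at least \<open>k\<close>.\<close>

lemma fact_mult_power_le_fact: "fact k * real k ^ i \<le> fact (i + k)"
proof (induction i)
  case (Suc i)
  have "fact k * real k ^ Suc i = real k * (fact k * real k ^ i)"
    by simp
  also have "\<dots> \<le> real (Suc i + k) * fact (i + k)"
    using Suc by (intro mult_mono) auto
  finally show ?case by simp
qed simp

text \<open>The series is dominated by its first term times a geometric series of ratio
  \<open>x / k \<le> 1 / e \<le> 1 / 2\<close>, whose sum is at most 2.\<close>

lemma exp_tail_le:
  assumes "0 \<le> x" "exp 1 * x \<le> real k" "k > 0"
  shows "exp_tail k x \<le> 2 * (x ^ k / fact k)"
proof -
  define r where "r = x / real k"
  have "2 * x \<le> exp 1 * x"
    using assms exp_ge_add_one_self[of 1] by (intro mult_right_mono) auto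
  then have r: "0 \<le> r" "r \<le> 1 / 2"
    using assms by (auto simp: r_def divide_simps)
  have "exp_tail k x = (\<Sum>i. x ^ (i + k) / fact (i + k))"
    by (rule exp_tail_eq_suminf)
  also have "\<dots> \<le> (\<Sum>i. x ^ k / fact k * r ^ i)"
  proof (intro suminf_le allI)
    fix i
    have "x ^ (i + k) / fact (i + k) \<le> x ^ (i + k) / (fact k * real k ^ i)"
      using assms fact_mult_power_le_fact[of k i] by (intro divide_left_mono) auto
    then show "x ^ (i + k) / fact (i + k) \<le> x ^ k / fact k * r ^ i"
      by (simp add: r_def power_add power_divide mult_ac)
    show "summable (\<lambda>i. x ^ (i + k) / fact (i + k))"
      using summable_ignore_initial_segment[OF summable_exp[of x], of k]
      by (simp add: divide_inverse mult.commute)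
    show "summable (\<lambda>i. x ^ k / fact k * r ^ i)"
      using r by (intro summable_mult summable_geometric) auto
  qed
  also have "\<dots> = x ^ k / fact k * (1 / (1 - r))"
    using r by (subst suminf_mult) (auto simp: suminf_geometric summable_geometric)
  also have "\<dots> \<le> x ^ k / fact k * 2"
    using r assms by (intro mult_left_mono) (auto simp: divide_simps)
  finally show ?thesis by (simp add: mult.commute)
qed

section \<open>An elementary substitute for Stirling's formula\<close>

text \<open>The difference of the two sides vanishes at 0 and has derivative
  \<open>y * (2 - y) / (3 * (1 + y))\<close>, which is nonnegative on the unit interval. The
  quadratic term supplies the gain in each step of \<open>power_div_exp_fact_le\<close>; the bound
  \<open>x\<close> alone would only give boundedness.\<close>

lemma ln_one_plus_le:
  fixes x :: real
  assumes "0 \<le> x" "x \<le> 1"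
  shows "ln (1 + x) \<le> x - x\<^sup>2 / 6"
proof -
  define f where "f = (\<lambda>x::real. x - x\<^sup>2 / 6 - ln (1 + x))"
  have "f 0 \<le> f x"
  proof (rule DERIV_nonneg_imp_nondecreasing[OF assms(1)])
    fix y assume y: "0 \<le> y" "y \<le> x"
    have "(f has_real_derivative (1 - y / 3 - 1 / (1 + y))) (at y)"
      unfolding f_def using y by (auto intro!: derivative_eq_intros)
    moreover have "1 - y / 3 - 1 / (1 + y) = y * (2 - y) / (3 * (1 + y))"
      using y by (simp add: field_simps)
    moreover have "y * (2 - y) / (3 * (1 + y)) \<ge> 0"
      using y assms by (intro divide_nonneg_nonneg mult_nonneg_nonneg) auto
    ultimately show "\<exists>d. (f has_real_derivative d) (at y) \<and> d \<ge> 0"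
      by metis
  qed
  then show ?thesis by (simp add: f_def)
qed

text \<open>Passing from \<open>N\<close> to \<open>N + 1\<close> multiplies
  \<open>(N / e) ^ N / fact N\<close> by \<open>(1 + 1 / N) ^ N / e\<close>, which is at most
  \<open>exp (- 1 / (6 * N))\<close>. These gains multiply to an exponential of a harmonic number,
  which tends to 0 because the harmonic series diverges.\<close>

lemma power_div_exp_fact_le:
  "(real (Suc n) / exp 1) ^ Suc n / fact (Suc n) \<le> exp (- harm n / 6)"
proof (induction n)
  case 0
  then show ?case by (simp add: harm_def)
next
  case (Suc n)
  define N where "N = real (Suc n)"
  have N: "N \<ge> 1" by (simp add: N_def)
  have "N * ln (1 + 1 / N) \<le> N * (1 / N - (1 / N)\<^sup>2 / 6)"
    using N by (intro mult_left_mono ln_one_plus_le) auto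
  also have "\<dots> = 1 - 1 / (6 * N)"
    using N by (simp add: field_simps power2_eq_square)
  finally have "exp (N * ln (1 + 1 / N)) \<le> exp (1 - 1 / (6 * N))"
    by simp
  moreover have "exp (N * ln (1 + 1 / N)) = (1 + 1 / N) ^ Suc n"
    using N by (simp only: N_def exp_of_nat_mult) (simp add: add_pos_nonneg)
  ultimately have pow: "(1 + 1 / N) ^ Suc n / exp 1 \<le> exp (- (1 / N) / 6)"
    by (simp add: exp_diff exp_minus field_simps)
  have "(N + 1) / N = 1 + 1 / N" using N by (simp add: field_simps)
  then have Np: "(N + 1) ^ Suc n = (1 + 1 / N) ^ Suc n * N ^ Suc n"
    using N by (metis nonzero_divide_eq_eq power_mult_distrib not_one_le_zero)
  \<comment> \<open>Used with \<open>a = N + 1\<close>: one factor of the power cancels against the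
    leading factor of the factorial.\<close>
  have cancel: "(a / b) ^ Suc m / (a * c) = a ^ m / (b * b ^ m * c)" if "a \<noteq> 0" for a b c :: real and m
    using that by (simp add: power_divide)
  have "(real (Suc (Suc n)) / exp 1) ^ Suc (Suc n) / fact (Suc (Suc n))
      = ((N + 1) / exp 1) ^ Suc (Suc n) / ((N + 1) * fact (Suc n))"
    unfolding fact_Suc[of "Suc n"] by (simp add: N_def add.commute)
  also have "\<dots> = (N + 1) ^ Suc n / (exp 1 * exp 1 ^ Suc n * fact (Suc n))"
    using N by (intro cancel) simp
  also have "\<dots> = ((N / exp 1) ^ Suc n / fact (Suc n)) * ((1 + 1 / N) ^ Suc n / exp 1)"
    unfolding Np by (simp del: power_Suc fact_Suc add: power_divide field_simps)
  also have "\<dots> \<le> exp (- harm n / 6) * exp (- (1 / N) / 6)"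
    using Suc pow N unfolding N_def[symmetric] by (intro mult_mono) (auto simp: N_def)
  also have "\<dots> = exp (- harm (Suc n) / 6)"
    by (simp add: harm_Suc N_def exp_add[symmetric] inverse_eq_divide) (simp add: field_simps)
  finally show ?case .
qed

lemma power_div_exp_fact_tendsto_0:
  "(\<lambda>n. (real n / exp 1) ^ n / fact n) \<longlonglongrightarrow> 0"
proof -
  have "(\<lambda>n. (real (Suc n) / exp 1) ^ Suc n / fact (Suc n)) \<longlonglongrightarrow> 0"
  proof (rule tendsto_sandwich[OF _ _ tendsto_const])
    have "((\<lambda>x::real. exp (- x / 6)) \<longlongrightarrow> 0) at_top"
      by real_asymp
    then show "(\<lambda>n. exp (- harm n / 6) :: real) \<longlonglongrightarrow> 0"
      by (rule filterlim_compose[OF _ harm_at_top])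
    show "\<forall>\<^sub>F n in sequentially. 0 \<le> (real (Suc n) / exp 1) ^ Suc n / fact (Suc n)"
      by simp
    show "\<forall>\<^sub>F n in sequentially. (real (Suc n) / exp 1) ^ Suc n / fact (Suc n) \<le> exp (- harm n / 6)"
      using power_div_exp_fact_le by simp
  qed
  then show ?thesis by (rule LIMSEQ_imp_Suc)
qed

text \<open>The sequence \<open>harm n - ln n\<close> is decreasing and has the value 1 at
  \<open>n = 1\<close>.\<close>

lemma harm_le_ln_plus_1: "n > 0 \<Longrightarrow> harm n \<le> (1 + ln (real n) :: real)"
  using decseqD[OF decseq_harm_diff_ln, of 0 "n - 1"] by (simp add: harm_def)

text \<open>For \<open>n > 0\<close> the assumptions give \<open>L n \<le> k n / e\<close>, so the
  tail is at most twice \<open>(k / e) ^ k / fact k\<close> at \<open>k = k n\<close>. This tends to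
  0 because \<open>k n\<close> tends to infinity.\<close>

lemma exp_tail_ln_tendsto_0:
  assumes L: "\<And>n. 0 \<le> L n" "\<And>n. n > 0 \<Longrightarrow> L n \<le> 1 + ln (real n)"
    and k: "\<And>n. exp 1 * (1 + ln (real n)) \<le> real (k n)"
  shows "(\<lambda>n. exp_tail (k n) (L n)) \<longlonglongrightarrow> 0"
proof (rule tendsto_sandwich[OF _ _ tendsto_const])
  have "filterlim (\<lambda>n. exp 1 * (1 + ln (real n))) at_top sequentially"
    by real_asymp
  then have "filterlim (\<lambda>n. real (k n)) at_top sequentially"
    by (rule filterlim_at_top_mono) (use k in simp)
  then have "filterlim k sequentially sequentially"
    by (simp add: filterlim_sequentially_iff_filterlim_real)
  then show "(\<lambda>n. 2 * ((real (k n) / exp 1) ^ k n / fact (k n))) \<longlonglongrightarrow> 0"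
    using tendsto_mult_right_zero[OF filterlim_compose[OF power_div_exp_fact_tendsto_0], of k _ 2]
    by simp
  show "\<forall>\<^sub>F n in sequentially. 0 \<le> exp_tail (k n) (L n)"
    using L by (simp add: exp_tail_nonneg)
  show "\<forall>\<^sub>F n in sequentially. exp_tail (k n) (L n) \<le> 2 * ((real (k n) / exp 1) ^ k n / fact (k n))"
    using eventually_gt_at_top[of 0]
  proof eventually_elim
    case (elim n)
    have "exp 1 * L n \<le> exp 1 * (1 + ln (real n))"
      using L elim by (intro mult_left_mono) auto
    then have le: "exp 1 * L n \<le> real (k n)" by (rule order_trans[OF _ k])
    have "0 < exp 1 * (1 + ln (real n))"
      using elim by (intro mult_pos_pos add_pos_nonneg) auto
    then have "k n > 0" using k[of n] by simp
    then have "exp_tail (k n) (L n) \<le> 2 * (L n ^ k n / fact (k n))"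
      using le L by (intro exp_tail_le) auto
    also have "\<dots> \<le> 2 * ((real (k n) / exp 1) ^ k n / fact (k n))"
      using le L by (intro mult_left_mono divide_right_mono power_mono) (auto simp: field_simps)
    finally show ?case .
  qed
qed

section \<open>Deterministic structure of the generated graphs\<close>

text \<open>All the information that is extracted from the burning process: started with
  \<open>visited = {}\<close> and \<open>ws = [w]\<close>, it joins the new vertex to the ambassador
  \<open>w\<close> and only to vertices of \<open>G\<close>. Marks are never removed, each listed
  vertex gets marked, and selected vertices lie in \<open>G\<close>.\<close>

lemma set_pmf_burn:
  assumes "finite (verts G)" "visited \<union> set ws \<subseteq> verts G" "S \<in> set_pmf (burn p q G visited ws)"
  shows "visited \<union> set ws \<subseteq> S" "S \<subseteq> verts G"
proof -
  have "visited \<union> set ws \<subseteq> S \<and> S \<subseteq> verts G"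
    using assms
  proof (induction p q G visited ws rule: burn.induct)
    case (2 p q G visited w ws)
    then obtain xs where xs: "xs \<in> set_pmf (select_neighbours p q G (insert w visited) w)"
      "S \<in> set_pmf (burn p q G (insert w visited) (xs @ ws))"
      by auto
    then have "set xs \<subseteq> verts G"
      using set_pmf_select_neighbours[OF 2(2) xs(1)] by auto
    then have "insert w visited \<union> set (xs @ ws) \<subseteq> S \<and> S \<subseteq> verts G"
      by (intro "2.IH"[OF _ _ _ _ xs(2)]) (use 2(2,3) xs(1) in auto)
    then show ?case by auto
  qed auto
  then show "visited \<union> set ws \<subseteq> S" "S \<subseteq> verts G" by auto
qed

text \<open>An invariant holding surely at time \<open>t\<close>. Through \<open>subgraph\<close> it
  also provides that \<open>G\<close> is well-formed and that its tail and head functions are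
  \<open>arc_tail G0\<close> and \<open>arc_head G0\<close>; the explicit vertex set gives the exact
  number of vertices.\<close>

definition grown :: "('a, 'b) pre_digraph \<Rightarrow> nat \<Rightarrow> ('a vertex, ('a, 'b) edge) pre_digraph \<Rightarrow> bool" where
  "grown G0 t G \<longleftrightarrow> subgraph (initial_graph G0) G \<and> verts G = Init ` verts G0 \<union> New ` {1..t}"

lemma grown_finite: "finite (verts G)" if "grown G0 t G" "finite (verts G0)"
  using that by (simp add: grown_def)

lemma grown_card:
  fixes G0 :: "('a, 'b) pre_digraph"
  assumes "grown G0 t G" "finite (verts G0)"
  shows "card (verts G) = card (verts G0) + t"
proof -
  have "card (Init ` verts G0 \<union> New ` {1..t}) = card (Init ` verts G0) + card (New ` {1..t} :: 'a vertex set)"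
    using assms by (intro card_Un_disjoint) auto
  then show ?thesis
    using assms by (simp add: grown_def card_image inj_on_def)
qed

lemma wf_digraph_initial_graph: "wf_digraph (initial_graph G0)" if "wf_digraph G0"
  using that unfolding wf_digraph_def by (auto simp: initial_graph_def)

lemma grown_initial_graph: "grown G0 0 (initial_graph G0)" if "wf_digraph G0"
  using wf_digraph_initial_graph[OF that]
  by (auto simp: grown_def subgraph_def compatible_def) (auto simp: initial_graph_def)

lemma subgraph_join_new_vertex:
  assumes "grown G0 t G" "S \<subseteq> verts G"
  shows "subgraph G (join_new_vertex s S G)"
proof -
  have "wf_digraph G" "tail G = arc_tail G0" "head G = arc_head G0"
    using assms by (auto simp: grown_def subgraph_def compatible_def initial_graph_def)
  with assms(2) show ?thesis
    by (auto simp: subgraph_def compatible_def join_new_vertex_def wf_digraph_def)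
qed

lemma grown_join_new_vertex:
  assumes "grown G0 t G" "S \<subseteq> verts G"
  shows "grown G0 (Suc t) (join_new_vertex (Suc t) S G)"
proof -
  have "subgraph (initial_graph G0) (join_new_vertex (Suc t) S G)"
    using assms subgraph_join_new_vertex[OF assms, of "Suc t"] subgraph_trans unfolding grown_def by blast
  then show ?thesis
    using assms by (auto simp: grown_def join_new_vertex_def atLeastAtMostSuc_conv)
qed

lemma grown_forest_fire:
  assumes "wf_digraph G0" "finite (verts G0)" "verts G0 \<noteq> {}" "G \<in> set_pmf (forest_fire p q G0 t)"
  shows "grown G0 t G"
  using assms(4)
proof (induction t arbitrary: G)
  case 0
  then show ?case using grown_initial_graph[OF assms(1)] by simp
next
  case (Suc t)
  then obtain H w S where H: "H \<in> set_pmf (forest_fire p q G0 t)" and w: "w \<in> set_pmf (pmf_of_set (verts H))"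
    and S: "S \<in> set_pmf (burn p q H {} [w])" and G: "G = join_new_vertex (Suc t) S H"
    by auto
  have gr: "grown G0 t H" using Suc.IH[OF H] .
  have "finite (verts H)" "verts H \<noteq> {}"
    using gr assms by (auto simp: grown_def)
  then have "S \<subseteq> verts H"
    using w S set_pmf_burn(2)[of H "{}" "[w]" S p q] by auto
  then show ?case
    unfolding G using gr by (rule grown_join_new_vertex[rotated])
qed

section \<open>Expected number of vertices far from the initial graph\<close>

text \<open>The vertices at directed distance at least \<open>j\<close> from the initial graph. A
  vertex without any walk to it is deep for every \<open>j\<close>, so emptiness of this set
  includes reachability.\<close>

definition deep :: "('a, 'b) pre_digraph \<Rightarrow> nat \<Rightarrow> ('a vertex, ('a, 'b) edge) pre_digraph \<Rightarrow> 'a vertex set" where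
  "deep G0 j G = {v \<in> verts G. \<forall>u\<in>Init ` verts G0. \<forall>P. pre_digraph.awalk G v P u \<longrightarrow> j \<le> length P}"

lemma awalk_subgraph: "pre_digraph.awalk G u P v" if "pre_digraph.awalk H u P v" "subgraph H G"
  using that by (meson subgraph_def wf_digraph.subgraph_awalk_imp_awalk)

text \<open>Old walks survive, so no old vertex becomes deep. A walk from \<open>w\<close>, prefixed
  by the arc from \<open>New s\<close> to \<open>w\<close>, is a walk from \<open>New s\<close>;
  hence \<open>w\<close> is at most one level less deep. For \<open>j = 0\<close> the truncated
  \<open>j - 1\<close> is harmless, as \<open>deep G0 0 G\<close> is all of
  \<open>verts G\<close>.\<close>

lemma deep_join_new_vertex:
  assumes gr: "grown G0 t G" and S: "S \<subseteq> verts G" "w \<in> S"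
  shows "deep G0 j (join_new_vertex s S G)
    \<subseteq> deep G0 j G \<union> (if w \<in> deep G0 (j - 1) G then {New s} else {})"
proof
  let ?G' = "join_new_vertex s S G"
  have sub: "subgraph G ?G'" using subgraph_join_new_vertex[OF gr S(1)] .
  then interpret G': wf_digraph ?G' by (simp add: subgraph_def)
  fix v assume v: "v \<in> deep G0 j ?G'"
  show "v \<in> deep G0 j G \<union> (if w \<in> deep G0 (j - 1) G then {New s} else {})"
  proof (cases "v \<in> verts G")
    case True
    then show ?thesis using v awalk_subgraph[OF _ sub] by (auto simp: deep_def)
  next
    case False
    then have v_eq: "v = New s" using v by (auto simp: deep_def join_new_vertex_def)
    have "j - 1 \<le> length P" if "u \<in> Init ` verts G0" "pre_digraph.awalk G w P u" for u P
    proof -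
      have "tail ?G' = arc_tail G0" "head ?G' = arc_head G0"
        using gr by (auto simp: grown_def subgraph_def compatible_def initial_graph_def join_new_vertex_def)
      moreover have "NewArc s w \<in> arcs ?G'"
        using S by (simp add: join_new_vertex_def)
      ultimately have "G'.awalk v (NewArc s w # P) u"
        using awalk_subgraph[OF that(2) sub] by (simp add: G'.awalk_Cons_iff v_eq)
      then have "j \<le> length (NewArc s w # P)"
        using v that(1) unfolding deep_def by blast
      then show ?thesis by simp
    qed
    then show ?thesis using S by (auto simp: deep_def v_eq)
  qed
qed

lemma card_deep_join_new_vertex:
  fixes G0 :: "('a, 'b) pre_digraph"
  assumes "grown G0 t G" "S \<subseteq> verts G" "w \<in> S" "finite (verts G)"
  shows "card (deep G0 j (join_new_vertex s S G)) \<le> card (deep G0 j G) + indicator (deep G0 (j - 1) G) w"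
proof -
  define N :: "'a vertex set" where "N = (if w \<in> deep G0 (j - 1) G then {New s} else {})"
  have fin: "finite (deep G0 j G)" using assms(4) by (simp add: deep_def)
  have "card (deep G0 j (join_new_vertex s S G)) \<le> card (deep G0 j G \<union> N)"
    using deep_join_new_vertex[OF assms(1-3)] fin by (intro card_mono) (auto simp: N_def)
  also have "\<dots> \<le> card (deep G0 j G) + card N"
    by (rule card_Un_le)
  finally show ?thesis by (simp add: N_def indicator_def split: if_splits)
qed

text \<open>The empty walk shows that initial vertices have distance 0.\<close>

lemma deep_initial_graph: "deep G0 (Suc j) (initial_graph G0) = {}"
proof -
  have "pre_digraph.awalk (initial_graph G0) (Init v) [] (Init v)" if "v \<in> verts G0" for v
    using that by (simp add: pre_digraph.awalk_def pre_digraph.cas.simps initial_graph_def)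
  then show ?thesis
    by (fastforce simp: deep_def initial_graph_def)
qed

text \<open>The recursion for \<open>a\<^sub>j(t)\<close> solved by induction on \<open>t\<close>,
  with \<open>j\<close> arbitrary because the step refers to \<open>j - 1\<close>. At time 0 all
  \<open>m\<close> vertices count for \<open>j = 0\<close>, where \<open>exp_tail 0 0 = 1\<close>,
  and none for larger \<open>j\<close>.\<close>

lemma nn_integral_card_deep_le:
  assumes G0: "wf_digraph G0" "finite (verts G0)" "verts G0 \<noteq> {}"
  defines "m \<equiv> real (card (verts G0))"
  shows "(\<integral>\<^sup>+G. of_nat (card (deep G0 j G)) \<partial>forest_fire p q G0 t)
    \<le> ennreal (m * exp_tail j (\<Sum>s<t. 1 / (m + real s)))"
proof (induction t arbitrary: j)
  case 0
  show ?case
  proof (cases j)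
    case 0
    have "card (deep G0 0 (initial_graph G0)) = card (verts G0)"
      by (simp add: deep_def initial_graph_def card_image inj_on_def)
    then show ?thesis
      by (simp add: 0 m_def exp_tail_def ennreal_of_nat_eq_real_of_nat)
  qed (simp add: deep_initial_graph)
next
  case (Suc t)
  define L where "L = (\<Sum>s<t. 1 / (m + real s))"
  have m: "m \<ge> 1"
    using G0 by (simp add: m_def Suc_le_eq card_gt_0_iff)
  have L: "L \<ge> 0" unfolding L_def using m by (intro sum_nonneg) auto
  let ?M = "forest_fire p q G0 t"
  have "(\<integral>\<^sup>+G. of_nat (card (deep G0 j G)) \<partial>forest_fire p q G0 (Suc t))
     = (\<integral>\<^sup>+G. \<integral>\<^sup>+w. \<integral>\<^sup>+S. of_nat (card (deep G0 j (join_new_vertex (Suc t) S G)))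
          \<partial>burn p q G {} [w] \<partial>pmf_of_set (verts G) \<partial>?M)"
    by simp
  also have "\<dots> \<le> (\<integral>\<^sup>+G. of_nat (card (deep G0 j G)) + of_nat (card (deep G0 (j - 1) G)) * ennreal (1 / (m + real t)) \<partial>?M)"
  proof (intro nn_integral_mono_AE, unfold AE_measure_pmf_iff, intro ballI)
    fix G assume "G \<in> set_pmf ?M"
    then have gr: "grown G0 t G" using grown_forest_fire[OF G0] by blast
    have fin: "finite (verts G)" and ne: "verts G \<noteq> {}"
      using gr G0 by (auto simp: grown_def)
    have "(\<integral>\<^sup>+w. \<integral>\<^sup>+S. of_nat (card (deep G0 j (join_new_vertex (Suc t) S G)))
          \<partial>burn p q G {} [w] \<partial>pmf_of_set (verts G))
        \<le> (\<integral>\<^sup>+w. of_nat (card (deep G0 j G)) + indicator (deep G0 (j - 1) G) w \<partial>pmf_of_set (verts G))"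
    proof (intro nn_integral_mono_AE, unfold AE_measure_pmf_iff, intro ballI)
      fix w assume "w \<in> set_pmf (pmf_of_set (verts G))"
      then have w: "w \<in> verts G" using fin ne by simp
      have "(\<integral>\<^sup>+S. of_nat (card (deep G0 j (join_new_vertex (Suc t) S G))) \<partial>burn p q G {} [w])
          \<le> (\<integral>\<^sup>+S. of_nat (card (deep G0 j G) + indicator (deep G0 (j - 1) G) w) \<partial>burn p q G {} [w])"
      proof (intro nn_integral_mono_AE, unfold AE_measure_pmf_iff, intro ballI)
        fix S assume "S \<in> set_pmf (burn p q G {} [w])"
        then have "w \<in> S" "S \<subseteq> verts G"
          using set_pmf_burn[of G "{}" "[w]" S p q] fin w by auto
        then show "(of_nat (card (deep G0 j (join_new_vertex (Suc t) S G))) :: ennreal)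
            \<le> of_nat (card (deep G0 j G) + indicator (deep G0 (j - 1) G) w)"
          using card_deep_join_new_vertex[OF gr _ _ fin] by (intro of_nat_mono) blast
      qed
      \<comment> \<open>The bound does not depend on \<open>S\<close>, so integrating over the law
        of \<open>S\<close> leaves it unchanged.\<close>
      also have "\<dots> = of_nat (card (deep G0 j G)) + indicator (deep G0 (j - 1) G) w"
        by (simp add: measure_pmf.emeasure_space_1 indicator_def)
      finally show "(\<integral>\<^sup>+S. of_nat (card (deep G0 j (join_new_vertex (Suc t) S G))) \<partial>burn p q G {} [w])
          \<le> of_nat (card (deep G0 j G)) + indicator (deep G0 (j - 1) G) w" .
    qed
    \<comment> \<open>Averaging over the uniform ambassador turns the indicator into the proportion
      of deep vertices among the \<open>m + t\<close> present.\<close>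
    also have "\<dots> = of_nat (card (deep G0 j G)) + emeasure (pmf_of_set (verts G)) (deep G0 (j - 1) G)"
      by (subst nn_integral_add) (auto simp: measure_pmf.emeasure_space_1)
    also have "emeasure (pmf_of_set (verts G)) (deep G0 (j - 1) G)
        = ennreal (real (card (deep G0 (j - 1) G)) / real (card (verts G)))"
    proof -
      have "verts G \<inter> deep G0 (j - 1) G = deep G0 (j - 1) G" by (auto simp: deep_def)
      then show ?thesis
        using fin ne by (simp add: emeasure_pmf_of_set)
    qed
    also have "\<dots> = of_nat (card (deep G0 (j - 1) G)) * ennreal (1 / (m + real t))"
      using m grown_card[OF gr G0(2)]
      by (simp add: m_def ennreal_of_nat_eq_real_of_nat ennreal_mult[symmetric])
    finally show "(\<integral>\<^sup>+w. \<integral>\<^sup>+S. of_nat (card (deep G0 j (join_new_vertex (Suc t) S G)))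
          \<partial>burn p q G {} [w] \<partial>pmf_of_set (verts G))
        \<le> of_nat (card (deep G0 j G)) + of_nat (card (deep G0 (j - 1) G)) * ennreal (1 / (m + real t))" .
  qed
  also have "\<dots> = (\<integral>\<^sup>+G. of_nat (card (deep G0 j G)) \<partial>?M)
      + (\<integral>\<^sup>+G. of_nat (card (deep G0 (j - 1) G)) \<partial>?M) * ennreal (1 / (m + real t))"
    by (simp add: nn_integral_add nn_integral_multc)
  also have "\<dots> \<le> ennreal (m * exp_tail j L) + ennreal (m * exp_tail (j - 1) L) * ennreal (1 / (m + real t))"
    using Suc.IH unfolding L_def by (intro add_mono mult_right_mono) auto
  also have "\<dots> = ennreal (m * (exp_tail j L + 1 / (m + real t) * exp_tail (j - 1) L))"
    using m L exp_tail_nonneg[OF L]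
    by (simp add: ennreal_mult[symmetric] ennreal_plus[symmetric] algebra_simps del: ennreal_plus)
  also have "\<dots> \<le> ennreal (m * exp_tail j (L + 1 / (m + real t)))"
    using m L by (intro ennreal_leI mult_left_mono exp_tail_add_ge) auto
  finally show ?case by (simp add: L_def)
qed

section \<open>From expectation to probability\<close>

text \<open>Markov's inequality: a nonempty finite set has at least one element.\<close>

lemma prob_deep_le:
  assumes G0: "wf_digraph G0" "finite (verts G0)" "verts G0 \<noteq> {}"
  defines "m \<equiv> real (card (verts G0))"
  shows "measure_pmf.prob (forest_fire p q G0 t) {G. deep G0 j G \<noteq> {}}
    \<le> m * exp_tail j (\<Sum>s<t. 1 / (m + real s))"
proof -
  let ?M = "forest_fire p q G0 t"
  have "emeasure ?M {G. deep G0 j G \<noteq> {}} = (\<integral>\<^sup>+G. indicator {G. deep G0 j G \<noteq> {}} G \<partial>?M)"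
    by simp
  also have "\<dots> \<le> (\<integral>\<^sup>+G. of_nat (card (deep G0 j G)) \<partial>?M)"
  proof (intro nn_integral_mono_AE, unfold AE_measure_pmf_iff, intro ballI)
    fix G assume "G \<in> set_pmf ?M"
    then have "finite (deep G0 j G)"
      using grown_finite[OF grown_forest_fire[OF G0] G0(2)] by (auto simp: deep_def)
    then have "deep G0 j G \<noteq> {} \<Longrightarrow> 1 \<le> card (deep G0 j G)"
      by (simp add: Suc_le_eq card_gt_0_iff)
    then show "indicator {G. deep G0 j G \<noteq> {}} G \<le> (of_nat (card (deep G0 j G)) :: ennreal)"
      using of_nat_mono[of 1 "card (deep G0 j G)", where 'a = ennreal]
      by (auto simp: indicator_def)
  qed
  also have "\<dots> \<le> ennreal (m * exp_tail j (\<Sum>s<t. 1 / (m + real s)))"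
    unfolding m_def by (rule nn_integral_card_deep_le[OF G0])
  finally show ?thesis
    by (simp add: measure_pmf.emeasure_eq_measure m_def exp_tail_nonneg sum_nonneg)
qed

text \<open>As \<open>m \<ge> 1\<close>, the sum of \<open>1 / (m + s)\<close> is at most
  \<open>harm n\<close>, hence at most \<open>1 + ln n\<close>, and
  \<open>exp_tail_ln_tendsto_0\<close> applies. The event carries \<open>grown\<close> along, which
  holds on the whole support, so that the path and diameter bounds can be derived from it
  deterministically.\<close>

lemma asymptotically_almost_surely_not_deep:
  assumes G0: "wf_digraph G0" "finite (verts G0)" "verts G0 \<noteq> {}"
    and k: "\<And>n. exp 1 * (1 + ln (real n)) \<le> real (k n)"
  shows "asymptotically_almost_surely (forest_fire p q G0)
    (\<lambda>n G. grown G0 n G \<and> deep G0 (k n) G = {})"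
proof -
  define m where "m = real (card (verts G0))"
  define L where "L = (\<lambda>n. \<Sum>s<n. 1 / (m + real s))"
  have m: "m \<ge> 1"
    using G0 by (simp add: m_def Suc_le_eq card_gt_0_iff)
  have L0: "L n \<ge> 0" for n unfolding L_def using m by (intro sum_nonneg) auto
  have L1: "L n \<le> 1 + ln (real n)" if "n > 0" for n
  proof -
    have "L n \<le> (\<Sum>s<n. inverse (of_nat (Suc s)))"
      unfolding L_def using m by (intro sum_mono) (auto simp: divide_simps)
    also have "\<dots> = harm n" by (simp add: harm_altdef)
    also have "\<dots> \<le> 1 + ln (real n)" using that by (rule harm_le_ln_plus_1)
    finally show ?thesis .
  qed
  let ?p = "\<lambda>n. measure_pmf.prob (forest_fire p q G0 n) {G. grown G0 n G \<and> deep G0 (k n) G = {}}"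
  have lower: "1 - m * exp_tail (k n) (L n) \<le> ?p n" for n
  proof -
    let ?M = "measure_pmf (forest_fire p q G0 n)"
    have "?p n = measure ?M {G. deep G0 (k n) G = {}}"
      using grown_forest_fire[OF G0]
      by (intro measure_pmf.finite_measure_eq_AE) (auto simp: AE_measure_pmf_iff)
    also have "\<dots> = 1 - measure ?M {G. deep G0 (k n) G \<noteq> {}}"
      using measure_pmf.prob_compl[of "{G. deep G0 (k n) G \<noteq> {}}" "forest_fire p q G0 n"]
      by (simp add: Compl_eq_Diff_UNIV[symmetric] Collect_neg_eq[symmetric])
    finally show ?thesis
      using prob_deep_le[OF G0, where j = "k n" and p = p and q = q and t = n] by (simp add: m_def L_def)
  qed
  have "(\<lambda>n. 1 - m * exp_tail (k n) (L n)) \<longlonglongrightarrow> 1 - m * 0"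
    using L0 L1 k by (intro tendsto_intros exp_tail_ln_tendsto_0)
  then have "(\<lambda>n. 1 - m * exp_tail (k n) (L n)) \<longlonglongrightarrow> 1" by simp
  from tendsto_sandwich[OF _ _ this tendsto_const[of 1]] have "?p \<longlonglongrightarrow> 1"
    by (simp add: lower)
  then show ?thesis by (simp add: asymptotically_almost_surely_def)
qed

lemma asymptotically_almost_surely_mono:
  assumes "asymptotically_almost_surely M P" "\<And>n G. P n G \<Longrightarrow> Q n G"
  shows "asymptotically_almost_surely M Q"
  unfolding asymptotically_almost_surely_def
proof (rule tendsto_sandwich[OF _ _ _ tendsto_const])
  show "(\<lambda>n. measure_pmf.prob (M n) {g. P n g}) \<longlonglongrightarrow> 1"
    using assms(1) by (simp add: asymptotically_almost_surely_def)
  show "\<forall>\<^sub>F n in sequentially. measure_pmf.prob (M n) {g. P n g} \<le> measure_pmf.prob (M n) {g. Q n g}"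
    using assms(2) by (intro always_eventually allI measure_pmf.finite_measure_mono) auto
qed simp

section \<open>Undirected walks and the diameter\<close>

text \<open>Walks are transported arc by arc. The map \<open>f\<close> allows two uses: the identity
  forgets directions in \<open>G\<close>, and \<open>Init\<close> carries undirected walks of
  \<open>G0\<close> into \<open>G\<close>.\<close>

lemma awalk_mk_symmetric_of_adj:
  assumes "wf_digraph G" "pre_digraph.awalk H u P v" "wf_digraph H" "f ` verts H \<subseteq> verts G"
    "\<And>e. e \<in> arcs H \<Longrightarrow> (f (tail H e), f (head H e)) \<in> parcs (mk_symmetric G)"
  shows "\<exists>Q. pre_digraph.awalk (mk_symmetric G) (f u) Q (f v) \<and> length Q = length P"
  using assms(2)
proof (induction P arbitrary: u)
  case Nil
  interpret H: wf_digraph H by fact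
  interpret S: pair_wf_digraph "mk_symmetric G"
    using assms(1) by (rule wf_digraph.wellformed_mk_symmetric)
  from Nil show ?case
    using assms(4) by (intro exI[of _ "[]"]) (auto simp: H.awalk_Nil_iff S.awalk_Nil_iff)
next
  case (Cons e P)
  interpret H: wf_digraph H by fact
  interpret S: pair_wf_digraph "mk_symmetric G"
    using assms(1) by (rule wf_digraph.wellformed_mk_symmetric)
  from Cons.prems have e: "e \<in> arcs H" "u = tail H e" "H.awalk (head H e) P v"
    by (auto simp: H.awalk_Cons_iff)
  from Cons.IH[OF e(3)] obtain Q where Q: "S.awalk (f (head H e)) Q (f v)" "length Q = length P"
    by blast
  show ?case
    using Q e assms(5)[OF e(1)]
    by (intro exI[of _ "(f u, f (head H e)) # Q"]) (auto simp: S.awalk_Cons_iff)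
qed

text \<open>In the symmetric closure every arc has its opposite.\<close>

lemma awalk_mk_symmetric_rev:
  assumes "wf_digraph G" "pre_digraph.awalk (mk_symmetric G) u P v"
  shows "\<exists>Q. pre_digraph.awalk (mk_symmetric G) v Q u \<and> length Q = length P"
  using assms(2)
proof (induction P arbitrary: u)
  case Nil
  then show ?case
    by (intro exI[of _ "[]"]) (auto simp: pre_digraph.awalk_def pre_digraph.cas.simps)
next
  case (Cons e P)
  interpret S: pair_wf_digraph "mk_symmetric G"
    using assms(1) by (rule wf_digraph.wellformed_mk_symmetric)
  from Cons.prems have e: "e \<in> parcs (mk_symmetric G)" "u = fst e" "S.awalk (snd e) P v"
    by (auto simp: S.awalk_Cons_iff)
  from Cons.IH[OF e(3)] obtain Q where Q: "S.awalk v Q (snd e)" "length Q = length P"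
    by blast
  have "(snd e, u) \<in> parcs (mk_symmetric G)"
    using e by (auto simp: parcs_mk_symmetric)
  then have "S.awalk (snd e) [(snd e, u)] u"
    using S.wellformed by (auto simp: S.awalk_simps)
  from S.awalk_appendI[OF Q(1) this] Q(2) show ?case
    by (intro exI[of _ "Q @ [(snd e, u)]"]) auto
qed

lemma undirected_dist_le_length:
  assumes "wf_digraph G" "pre_digraph.awalk (mk_symmetric G) u P v"
  shows "undirected_dist G u v \<le> ereal (real (length P))"
proof -
  interpret S: pair_wf_digraph "mk_symmetric G"
    using assms(1) by (rule wf_digraph.wellformed_mk_symmetric)
  have "S.awalk_cost (\<lambda>_. 1) P = real (length P)"
    by (induction P) auto
  then show ?thesis
    using S.min_cost_le_walk_cost[OF assms(2), of "\<lambda>_. 1"] by (simp add: undirected_dist_def)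
qed

lemma connected_initial_walks:
  assumes "fin_digraph G0" "Digraph_Component.connected G0"
  obtains D where "\<And>u v. u \<in> verts G0 \<Longrightarrow> v \<in> verts G0 \<Longrightarrow>
    \<exists>P. pre_digraph.awalk (mk_symmetric G0) u P v \<and> length P \<le> D"
proof -
  interpret fin_digraph G0 by fact
  interpret S: pair_wf_digraph "mk_symmetric G0" by (rule wellformed_mk_symmetric)
  have "\<forall>x\<in>verts G0 \<times> verts G0. \<exists>P. S.awalk (fst x) P (snd x)"
    using assms(2) by (auto simp: Digraph_Component.connected_def strongly_connected_def S.reachable_awalk)
  then obtain P where P: "\<And>x. x \<in> verts G0 \<times> verts G0 \<Longrightarrow> S.awalk (fst x) (P x) (snd x)"
    by metis
  \<comment> \<open>Finitely many pairs, one chosen walk for each: the total length dominates every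
    single length.\<close>
  define D where "D = (\<Sum>x\<in>verts G0 \<times> verts G0. length (P x))"
  have "\<exists>P. S.awalk u P v \<and> length P \<le> D" if "u \<in> verts G0" "v \<in> verts G0" for u v
    using P[of "(u, v)"] that member_le_sum[of "(u, v)" "verts G0 \<times> verts G0" "\<lambda>x. length (P x)"]
    by (intro exI[of _ "P (u, v)"]) (auto simp: D_def)
  then show ?thesis by (rule that)
qed

text \<open>Walk from \<open>x\<close> to the initial graph, cross it within \<open>D\<close> steps,
  and follow the walk of \<open>y\<close> backwards.\<close>

lemma graph_diameter_le:
  assumes "wf_digraph G0" "grown G0 t G" "deep G0 k G = {}"
    and D: "\<And>u v. u \<in> verts G0 \<Longrightarrow> v \<in> verts G0 \<Longrightarrow>
      \<exists>P. pre_digraph.awalk (mk_symmetric G0) u P v \<and> length P \<le> D"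
  shows "graph_diameter G \<le> ereal (2 * real k + real D)"
  unfolding graph_diameter_def
proof (intro SUP_least)
  have sub: "subgraph (initial_graph G0) G" using assms(2) by (simp add: grown_def)
  then have wf: "wf_digraph G" by (simp add: subgraph_def)
  interpret S0: pair_wf_digraph "mk_symmetric G0"
    using assms(1) by (rule wf_digraph.wellformed_mk_symmetric)
  interpret S: pair_wf_digraph "mk_symmetric G"
    using wf by (rule wf_digraph.wellformed_mk_symmetric)
  have to_init: "\<exists>u\<in>verts G0. \<exists>P. S.awalk x P (Init u) \<and> length P \<le> k" if "x \<in> verts G" for x
  proof -
    from that assms(3) obtain u P where u: "u \<in> verts G0"
      and P: "pre_digraph.awalk G x P (Init u)" "length P < k"
      by (auto simp: deep_def not_le)
    from awalk_mk_symmetric_of_adj[OF wf P(1) wf, of "\<lambda>x. x"] P(2) u show ?thesis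
      by (fastforce simp: parcs_mk_symmetric)
  qed
  fix x y assume "x \<in> verts G" "y \<in> verts G"
  then obtain u v P Q where u: "u \<in> verts G0" "S.awalk x P (Init u)" "length P \<le> k"
    and v: "v \<in> verts G0" "S.awalk y Q (Init v)" "length Q \<le> k"
    using to_init by meson
  obtain Q' where Q': "S.awalk (Init v) Q' y" "length Q' = length Q"
    using awalk_mk_symmetric_rev[OF wf v(2)] by blast
  obtain R0 where R0: "S0.awalk u R0 v" "length R0 \<le> D"
    using D[OF u(1) v(1)] by blast
  have "(Init (fst e), Init (snd e)) \<in> parcs (mk_symmetric G)" if "e \<in> parcs (mk_symmetric G0)" for e
  proof -
    have "InitArc ` arcs G0 \<subseteq> arcs G" "tail G = arc_tail G0" "head G = arc_head G0"
      using sub by (auto simp: subgraph_def compatible_def initial_graph_def)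
    then show ?thesis
      using that by (force simp: parcs_mk_symmetric)
  qed
  then obtain R where R: "S.awalk (Init u) R (Init v)" "length R = length R0"
    using awalk_mk_symmetric_of_adj[OF wf R0(1) S0.wf_digraph_axioms, of Init] assms(2)
    by (auto simp: grown_def)
  have "S.awalk x (P @ R @ Q') y"
    using u(2) R(1) Q'(1) by (intro S.awalk_appendI)
  from undirected_dist_le_length[OF wf this]
  have "undirected_dist G x y \<le> ereal (real (length (P @ R @ Q')))" .
  also have "\<dots> \<le> ereal (2 * real k + real D)"
    using u(3) v(3) R R0 Q' by simp
  finally show "undirected_dist G x y \<le> ereal (2 * real k + real D)" .
qed

section \<open>Directed paths and the final constants\<close>

text \<open>A vertex that is not deep at level \<open>Suc k\<close> has a walk of length at most
  \<open>k\<close>; cutting out cycles turns it into a path without lengthening it.\<close>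

lemma apath_of_not_deep:
  assumes "wf_digraph G" "deep G0 (Suc k) G = {}" "v \<in> verts G"
  shows "\<exists>u\<in>Init ` verts G0. \<exists>P. pre_digraph.apath G v P u \<and> length P \<le> k"
proof -
  interpret wf_digraph G by fact
  obtain u P where u: "u \<in> Init ` verts G0" and P: "awalk v P u" "length P \<le> k"
    using assms(2,3) unfolding deep_def by (force simp: not_le less_Suc_eq_le)
  have "\<exists>Q. apath v Q u \<and> length Q \<le> length P"
    using P(1)
  proof (induction P rule: awalk_to_apath_induct)
    case (path p)
    then show ?case by (auto simp: apath_def)
  next
    case (decomp p q r s)
    have "p = q @ r @ s"
      using decomp(2,1,3) by (rule awalk_cyc_decompE)
    then show ?case using decomp(4) by fastforce
  qed
  then show ?thesis using u P(2) by (meson order_trans)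
qed

theorem theorem2p2:
  fixes p q :: real and G0 :: "('a, 'b) pre_digraph"
  assumes "p \<in> {0..1}" and "q \<in> {0..1}"
    and "fin_digraph G0" and "Digraph_Component.connected G0"
  shows "(\<exists>C::real. asymptotically_almost_surely (forest_fire p q G0)
            (\<lambda>n G. \<forall>v\<in>verts G. \<exists>u\<in>Init ` verts G0. \<exists>P.
               pre_digraph.apath G v P u \<and> real (length P) \<le> exp 1 * ln (real n) + C))
       \<and> (\<exists>C'::real. asymptotically_almost_surely (forest_fire p q G0)
            (\<lambda>n G. graph_diameter G \<le> ereal (2 * exp 1 * ln (real n) + C')))"
proof -
  interpret fin_digraph G0 by fact
  have ne: "verts G0 \<noteq> {}"
    using assms(4) by (auto simp: Digraph_Component.connected_def strongly_connected_def)
  obtain D where D: "\<And>u v. u \<in> verts G0 \<Longrightarrow> v \<in> verts G0 \<Longrightarrow>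
      \<exists>P. pre_digraph.awalk (mk_symmetric G0) u P v \<and> length P \<le> D"
    using connected_initial_walks[OF assms(3,4)] by blast
  \<comment> \<open>Rounding down keeps path lengths within \<open>e * ln n + e\<close>, so
    \<open>C = e\<close> works, while \<open>Suc (k n)\<close> still exceeds the threshold
    \<open>e * (1 + ln n)\<close>.\<close>
  define k where "k = (\<lambda>n. nat \<lfloor>exp 1 * (1 + ln (real n))\<rfloor>)"
  have k: "exp 1 * (1 + ln (real n)) \<le> real (Suc (k n))" "real (k n) \<le> exp 1 * ln (real n) + exp 1" for n
  proof -
    \<comment> \<open>The case \<open>n = 0\<close> relies on the convention
      \<open>ln 0 = 0\<close>.\<close>
    have "0 \<le> ln (real n)" by (cases "n = 0") auto
    then have "0 \<le> exp 1 * (1 + ln (real n))" by simp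
    then show "exp 1 * (1 + ln (real n)) \<le> real (Suc (k n))" "real (k n) \<le> exp 1 * ln (real n) + exp 1"
      unfolding k_def by (auto simp: algebra_simps) linarith+
  qed
  have aas: "asymptotically_almost_surely (forest_fire p q G0)
      (\<lambda>n G. grown G0 n G \<and> deep G0 (Suc (k n)) G = {})"
    using wf_digraph_axioms finite_verts ne k(1) by (rule asymptotically_almost_surely_not_deep)
  have "asymptotically_almost_surely (forest_fire p q G0)
      (\<lambda>n G. \<forall>v\<in>verts G. \<exists>u\<in>Init ` verts G0. \<exists>P.
         pre_digraph.apath G v P u \<and> real (length P) \<le> exp 1 * ln (real n) + exp 1)"
  proof (rule asymptotically_almost_surely_mono[OF aas], intro ballI)
    fix n G v assume G: "grown G0 n G \<and> deep G0 (Suc (k n)) G = {}" "v \<in> verts G"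
    then obtain u P where "u \<in> Init ` verts G0" "pre_digraph.apath G v P u" "length P \<le> k n"
      using apath_of_not_deep[of G G0 "k n" v] by (auto simp: grown_def subgraph_def)
    moreover from this(3) have "real (length P) \<le> exp 1 * ln (real n) + exp 1"
      using k(2)[of n] by linarith
    ultimately show "\<exists>u\<in>Init ` verts G0. \<exists>P.
        pre_digraph.apath G v P u \<and> real (length P) \<le> exp 1 * ln (real n) + exp 1"
      by blast
  qed
  \<comment> \<open>The constant comes from \<open>2 * Suc (k n) + D\<close> with
    \<open>k n \<le> e * ln n + e\<close>.\<close>
  moreover have "asymptotically_almost_surely (forest_fire p q G0)
      (\<lambda>n G. graph_diameter G \<le> ereal (2 * exp 1 * ln (real n) + (2 * exp 1 + 2 + real D)))"
  proof (rule asymptotically_almost_surely_mono[OF aas])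
    fix n G assume "grown G0 n G \<and> deep G0 (Suc (k n)) G = {}"
    then have "graph_diameter G \<le> ereal (2 * real (Suc (k n)) + real D)"
      using graph_diameter_le[OF wf_digraph_axioms _ _ D] by blast
    also have "\<dots> \<le> ereal (2 * exp 1 * ln (real n) + (2 * exp 1 + 2 + real D))"
      using k(2)[of n] by simp
    finally show "graph_diameter G \<le> ereal (2 * exp 1 * ln (real n) + (2 * exp 1 + 2 + real D))" .
  qed
  ultimately show ?thesis by blast
qed

end
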